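(* Let $B=[b_{ij}]$ be the exponent matrix, with lifting degree $N$, of a single-edge protograph-based QC-LDPC code whose Tanner graph has no $4$-cycles. Consider the $3\times 3$ submatrix of $B$ with (distinct) rows $i_1,i_2,i_3$ and (distinct) columns $j_1,j_2,j_3$, and its $6$-entry vector $e=[e_1,\ldots,e_6]$, computed modulo $N$, where $$\begin{aligned} e_1&=(b_{i_1j_1}-b_{i_1j_2})+(b_{i_2j_2}-b_{i_2j_3})+(b_{i_3j_3}-b_{i_3j_1}),\\ e_2&=(b_{i_1j_1}-b_{i_1j_3})+(b_{i_2j_3}-b_{i_2j_2})+(b_{i_3j_2}-b_{i_3j_1}),\\ e_3&=(b_{i_1j_2}-b_{i_1j_3})+(b_{i_2j_3}-b_{i_2j_1})+(b_{i_3j_1}-b_{i_3j_2}),\\ e_4&=(b_{i_1j_3}-b_{i_1j_2})+(b_{i_2j_2}-b_{i_2j_1})+(b_{i_3j_1}-b_{i_3j_3}),\\ e_5&=(b_{i_1j_3}-b_{i_1j_1})+(b_{i_2j_1}-b_{i_2j_2})+(b_{i_3j_2}-b_{i_3j_3}),\\ e_6&=(b_{i_1j_2}-b_{i_1j_1})+(b_{i_2j_1}-b_{i_2j_3})+(b_{i_3j_3}-b_{i_3j_2}). \end{aligned}$$ Then the Tanner graph of this $3\times3$ submatrix contains no $8$-cycle with a chord if and only if none of the following holds (equalities modulo $N$): (1) $e_1=e_6=0$; (2) $e_1=e_2=0$; (3) $e_1=e_4=0$; (4) $e_2=e_5=0$; (5) $e_2=e_3=0$; (6) $e_3=e_4=0$;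 (7) $e_3=e_6=0$; (8) $e_4=e_5=0$; (9) $e_5=e_6=0$.
   Context: Single-edge QC-LDPC code: the exponent matrix $B=[b_{ij}]$ is a $c\times d$ matrix with entries in $\{0,1,\ldots,N-1\}\cup\{\infty\}$. The parity-check matrix is obtained by replacing each entry $b_{ij}\neq\infty$ by the $N\times N$ circulant permutation matrix whose top row has its $1$ in position $b_{ij}$ (positions $0,\ldots,N-1$) and whose $s$-th row is the top row cyclically shifted right $s$ times, and each $\infty$ by the $N\times N$ zero matrix. The Tanner graph is the simple bipartite graph with v-nodes (columns of the parity-check matrix) and c-nodes (rows), adjacent iff the entry is $1$. The Tanner graph of a submatrix of $B$ is the Tanner graph of the parity-check matrix obtained in the same way from that submatrix (equivalently, the corresponding subgraph of the full Tanner graph). If an expression $e_k$ involves an entry equal to $\infty$, it is regarded as nonzero. A cycle $C$ is a cycle with a chord if some c-node outside $C$ is adjacent to two distinct v-nodes of $C$, or some edge not in $C$ joins a v-node of $C$ to a c-node of $C$. *)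

theory Defs
  imports
    "HOL-Library.Extended_Nat"
    "HOL-Library.Z2"
    "Jordan_Normal_Form.Matrix"
    "Graph_Theory.Pair_Digraph"
begin

text \<open>
  Exponent matrices are \<open>c \<times> d\<close> matrices over \<^typ>\<open>enat\<close>, whose \<open>\<infinity>\<close> marks the zero blocks. All
  indices (rows, columns, positions inside a block) are counted from \<open>0\<close>.
\<close>

definition exponent_matrix :: "nat \<Rightarrow> enat mat \<Rightarrow> bool" where
  "exponent_matrix N B \<longleftrightarrow> N > 0 \<and> elements_mat B \<subseteq> enat ` {0..<N} \<union> {\<infinity>}"

text \<open>
  The top row has its \<open>1\<close> in position \<open>b\<close>, and shifting it right \<open>s\<close> times, cyclically, moves
  that \<open>1\<close> to position \<open>b + s\<close> modulo \<open>N\<close>.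
\<close>

definition circulant_perm_mat :: "nat \<Rightarrow> nat \<Rightarrow> bit mat" where
  "circulant_perm_mat N b = mat N N (\<lambda>(s, t). if t = (b + s) mod N then 1 else 0)"

definition lifted_block :: "nat \<Rightarrow> enat \<Rightarrow> bit mat" where
  "lifted_block N x = (case x of enat b \<Rightarrow> circulant_perm_mat N b | \<infinity> \<Rightarrow> 0\<^sub>m N N)"

definition parity_check_mat :: "nat \<Rightarrow> enat mat \<Rightarrow> bit mat" where
  "parity_check_mat N B = mat (dim_row B * N) (dim_col B * N)
     (\<lambda>(r, s). lifted_block N (B $$ (r div N, s div N)) $$ (r mod N, s mod N))"

text \<open>
  The row list \<open>is\<close> and the column list \<open>js\<close> need not be increasing; selection by index sets
  would put them in increasing order.
\<close>

definition select_mat :: "'a mat \<Rightarrow> nat list \<Rightarrow> nat list \<Rightarrow> 'a mat" where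
  "select_mat B is js = mat (length is) (length js) (\<lambda>(a, b). B $$ (is ! a, js ! b))"

datatype node = VNode nat | CNode nat

text \<open>
  A simple undirected graph is represented by the symmetric digraph that has both
  orientations of every edge.
\<close>

definition tanner_graph :: "bit mat \<Rightarrow> node pair_pre_digraph" where
  "tanner_graph H = \<lparr>
     pverts = VNode ` {0..<dim_col H} \<union> CNode ` {0..<dim_row H},
     parcs = {(VNode s, CNode r) | r s. r < dim_row H \<and> s < dim_col H \<and> H $$ (r, s) = 1} \<union>
             {(CNode r, VNode s) | r s. r < dim_row H \<and> s < dim_col H \<and> H $$ (r, s) = 1} \<rparr>"

lemma pair_graph_tanner_graph: "pair_graph (tanner_graph H)"
proof unfold_locales
  let ?f = "\<lambda>(r, s). (VNode s, CNode r)" and ?g = "\<lambda>(r, s). (CNode r, VNode s)"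
  let ?S = "{0..<dim_row H} \<times> {0..<dim_col H}"
  have "parcs (tanner_graph H) \<subseteq> ?f ` ?S \<union> ?g ` ?S"
    by (auto simp: tanner_graph_def image_iff)
  then show "finite (parcs (tanner_graph H))"
    by (rule finite_subset) auto
qed (auto simp: tanner_graph_def symmetric_def sym_def)

text \<open>
  \<^const>\<open>pre_digraph.cycle\<close> repeats no vertex, so a directed cycle with at least three arcs of a
  symmetric digraph is a cycle of the undirected graph, with a chosen starting point and
  direction. Back-and-forth walks along one edge have length \<open>2\<close> and play no role for
  \<open>n \<ge> 3\<close>.
\<close>

definition is_cycle_of_length :: "nat \<Rightarrow> 'a pair_pre_digraph \<Rightarrow> ('a \<times> 'a) list \<Rightarrow> bool" where
  "is_cycle_of_length n G p \<longleftrightarrow> pre_digraph.cycle (with_proj G) p \<and> length p = n"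

definition cycle_nodes :: "('a \<times> 'a) list \<Rightarrow> 'a set" where
  "cycle_nodes p = fst ` set p"

definition has_chord :: "node pair_pre_digraph \<Rightarrow> (node \<times> node) list \<Rightarrow> bool" where
  "has_chord G p \<longleftrightarrow>
     (\<exists>r s t. CNode r \<in> pverts G \<and> CNode r \<notin> cycle_nodes p \<and> s \<noteq> t \<and>
        VNode s \<in> cycle_nodes p \<and> VNode t \<in> cycle_nodes p \<and>
        (VNode s, CNode r) \<in> parcs G \<and> (VNode t, CNode r) \<in> parcs G) \<or>
     (\<exists>r s. VNode s \<in> cycle_nodes p \<and> CNode r \<in> cycle_nodes p \<and>
        (VNode s, CNode r) \<in> parcs G \<and>
        (VNode s, CNode r) \<notin> set p \<and> (CNode r, VNode s) \<notin> set p)"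

text \<open>
  The sum of the differences \<open>x - y\<close>, reduced modulo \<open>N\<close>. The value is \<^const>\<open>None\<close>, and
  hence different from \<^term>\<open>Some 0\<close>, as soon as an entry \<open>\<infinity>\<close> is involved.
\<close>

definition diff_sum_mod :: "nat \<Rightarrow> (enat \<times> enat) list \<Rightarrow> int option" where
  "diff_sum_mod N ps =
     (if \<exists>(x, y) \<in> set ps. x = \<infinity> \<or> y = \<infinity> then None
      else Some ((\<Sum>(x, y) \<leftarrow> ps. int (the_enat x) - int (the_enat y)) mod int N))"

definition e_vector ::
  "nat \<Rightarrow> enat mat \<Rightarrow> nat \<Rightarrow> nat \<Rightarrow> nat \<Rightarrow> nat \<Rightarrow> nat \<Rightarrow> nat \<Rightarrow> int option list" where
  "e_vector N B i1 i2 i3 j1 j2 j3 = (let b = (\<lambda>i j. B $$ (i, j)) in map (diff_sum_mod N)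
     [[(b i1 j1, b i1 j2), (b i2 j2, b i2 j3), (b i3 j3, b i3 j1)],
      [(b i1 j1, b i1 j3), (b i2 j3, b i2 j2), (b i3 j2, b i3 j1)],
      [(b i1 j2, b i1 j3), (b i2 j3, b i2 j1), (b i3 j1, b i3 j2)],
      [(b i1 j3, b i1 j2), (b i2 j2, b i2 j1), (b i3 j1, b i3 j3)],
      [(b i1 j3, b i1 j1), (b i2 j1, b i2 j2), (b i3 j2, b i3 j3)],
      [(b i1 j2, b i1 j1), (b i2 j1, b i2 j3), (b i3 j3, b i3 j2)]])"

end

theory Submission
  imports Defs
begin

text \<open>
  Without \<open>4\<close>-cycles, no edge joins two nodes of an \<open>8\<close>-cycle at distance \<open>3\<close>, and no outside
  c-node is adjacent to two v-nodes of it at distance \<open>2\<close>. So a chord is an outside c-node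
  adjacent to two opposite v-nodes, and it splits the cycle into two \<open>6\<close>-cycles sharing a path
  of length \<open>2\<close>. In a \<open>3 \<times> 3\<close> base matrix both \<open>6\<close>-cycles visit every row and column block, and
  they traverse the two blocks other than that of the shared c-node in opposite orders. Hence
  their base hexagons differ by exchanging two columns, and the \<open>9\<close> unordered pairs of such
  hexagons are the \<open>9\<close> listed pairs of entries of \<open>e\<close>. Conversely, closed base hexagons of this
  kind lift to \<open>6\<close>-cycles through a common path, and a further coincidence of nodes would create
  a \<open>4\<close>-cycle.
\<close>

section \<open>Adjacency in the Tanner graph and absence of 4-cycles\<close>

definition adj :: "bit mat \<Rightarrow> nat \<Rightarrow> nat \<Rightarrow> bool" where
  "adj H r s \<longleftrightarrow> r < dim_row H \<and> s < dim_col H \<and> H $$ (r, s) = 1"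

lemma adj_bounds: "adj H r s \<Longrightarrow> r < dim_row H" "adj H r s \<Longrightarrow> s < dim_col H"
  by (auto simp: adj_def)

lemma parcs_tanner_graph [simp]:
  "(VNode s, CNode r) \<in> parcs (tanner_graph H) \<longleftrightarrow> adj H r s"
  "(CNode r, VNode s) \<in> parcs (tanner_graph H) \<longleftrightarrow> adj H r s"
  "(VNode s, VNode s') \<notin> parcs (tanner_graph H)"
  "(CNode r, CNode r') \<notin> parcs (tanner_graph H)"
  by (auto simp: tanner_graph_def adj_def)

lemma pverts_tanner_graph [simp]:
  "VNode s \<in> pverts (tanner_graph H) \<longleftrightarrow> s < dim_col H"
  "CNode r \<in> pverts (tanner_graph H) \<longleftrightarrow> r < dim_row H"
  by (auto simp: tanner_graph_def)

lemmas cycle_unfold = is_cycle_of_length_def pre_digraph.cycle_def pre_digraph.awalk_def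

definition no_rectangle :: "bit mat \<Rightarrow> bool" where
  "no_rectangle H \<longleftrightarrow>
     (\<forall>r r' s s'. r \<noteq> r' \<longrightarrow> adj H r s \<longrightarrow> adj H r s' \<longrightarrow> adj H r' s \<longrightarrow> adj H r' s' \<longrightarrow> s = s')"

lemma no_rectangleD:
  assumes "no_rectangle H" "adj H r s" "adj H r s'" "adj H r' s" "adj H r' s'"
  shows "r = r' \<or> s = s'"
  using assms unfolding no_rectangle_def by blast

lemma no_rectangle_if_no_4_cycle:
  assumes "\<nexists>p. is_cycle_of_length 4 (tanner_graph H) p"
  shows "no_rectangle H"
  unfolding no_rectangle_def
proof (intro allI impI, rule ccontr)
  fix r r' s s'
  assume *: "r \<noteq> r'" "adj H r s" "adj H r s'" "adj H r' s" "adj H r' s'" "s \<noteq> s'"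
  have "is_cycle_of_length 4 (tanner_graph H)
      [(CNode r, VNode s), (VNode s, CNode r'), (CNode r', VNode s'), (VNode s', CNode r)]"
    using * by (auto simp: cycle_unfold pre_digraph.cas.simps pre_digraph.awalk_verts.simps adj_bounds)
  with assms show False by blast
qed

section \<open>Chorded 8-cycles as theta graphs\<close>

text \<open>The arguments begin with the c-node \<open>r\<close> and its two neighbours, so that two
  6-cycles sharing the path \<open>w\<close>, \<open>r\<close>, \<open>u\<close> agree in their
  first three arguments.\<close>

definition hexagon :: "bit mat \<Rightarrow> nat \<Rightarrow> nat \<Rightarrow> nat \<Rightarrow> nat \<Rightarrow> nat \<Rightarrow> nat \<Rightarrow> bool" where
  "hexagon H r w u r1 v r2 \<longleftrightarrow> distinct [r, r1, r2] \<and> distinct [w, u, v] \<and>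
     adj H r w \<and> adj H r u \<and> adj H r1 u \<and> adj H r1 v \<and> adj H r2 v \<and> adj H r2 w"

definition octagon ::
  "bit mat \<Rightarrow> nat \<Rightarrow> nat \<Rightarrow> nat \<Rightarrow> nat \<Rightarrow> nat \<Rightarrow> nat \<Rightarrow> nat \<Rightarrow> nat \<Rightarrow> bool" where
  "octagon H r0 s0 r1 s1 r2 s2 r3 s3 \<longleftrightarrow> distinct [r0, r1, r2, r3] \<and> distinct [s0, s1, s2, s3] \<and>
     adj H r0 s0 \<and> adj H r1 s0 \<and> adj H r1 s1 \<and> adj H r2 s1 \<and>
     adj H r2 s2 \<and> adj H r3 s2 \<and> adj H r3 s3 \<and> adj H r0 s3"

text \<open>By bipartiteness the two node types alternate along the arc list. The labels are chosen
  so that starting at a v-node or at a c-node yields the same \<open>octagon\<close>. Edges are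
  recovered up to orientation, since the arc list runs in one direction only.\<close>

lemma octagon_of_8_cycle:
  assumes "is_cycle_of_length 8 (tanner_graph H) p"
  obtains r0 s0 r1 s1 r2 s2 r3 s3 where "octagon H r0 s0 r1 s1 r2 s2 r3 s3"
    "cycle_nodes p = VNode ` {s0, s1, s2, s3} \<union> CNode ` {r0, r1, r2, r3}"
    "\<forall>(r, s) \<in> {(r0, s0), (r1, s0), (r1, s1), (r2, s1), (r2, s2), (r3, s2), (r3, s3), (r0, s3)}.
       (VNode s, CNode r) \<in> set p \<or> (CNode r, VNode s) \<in> set p"
proof -
  have "length p = 8" using assms by (simp add: is_cycle_of_length_def)
  then obtain a0 a1 a2 a3 a4 a5 a6 a7 where p0: "p = [a0, a1, a2, a3, a4, a5, a6, a7]"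
    by (auto simp: numeral_eq_Suc length_Suc_conv)
  then obtain x0 x1 x2 x3 x4 x5 x6 x7 where
    p: "p = [(x0, x1), (x1, x2), (x2, x3), (x3, x4), (x4, x5), (x5, x6), (x6, x7), (x7, x0)]"
    and dist: "distinct [x0, x1, x2, x3, x4, x5, x6, x7]"
    and arcs: "(x0, x1) \<in> parcs (tanner_graph H)" "(x1, x2) \<in> parcs (tanner_graph H)"
      "(x2, x3) \<in> parcs (tanner_graph H)" "(x3, x4) \<in> parcs (tanner_graph H)"
      "(x4, x5) \<in> parcs (tanner_graph H)" "(x5, x6) \<in> parcs (tanner_graph H)"
      "(x6, x7) \<in> parcs (tanner_graph H)" "(x7, x0) \<in> parcs (tanner_graph H)"
    using assms
    by (cases a0; cases a1; cases a2; cases a3; cases a4; cases a5; cases a6; cases a7)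
      (auto simp: cycle_unfold pre_digraph.cas.simps pre_digraph.awalk_verts.simps)
  show thesis
  proof (cases x0)
    case (CNode r0)
    obtain s0 where x1: "x1 = VNode s0" using arcs(1) CNode by (cases x1) auto
    obtain r1 where x2: "x2 = CNode r1" using arcs(2) x1 by (cases x2) auto
    obtain s1 where x3: "x3 = VNode s1" using arcs(3) x2 by (cases x3) auto
    obtain r2 where x4: "x4 = CNode r2" using arcs(4) x3 by (cases x4) auto
    obtain s2 where x5: "x5 = VNode s2" using arcs(5) x4 by (cases x5) auto
    obtain r3 where x6: "x6 = CNode r3" using arcs(6) x5 by (cases x6) auto
    obtain s3 where x7: "x7 = VNode s3" using arcs(7) x6 by (cases x7) auto
    note x = CNode x1 x2 x3 x4 x5 x6 x7
    have "octagon H r0 s0 r1 s1 r2 s2 r3 s3"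
      using arcs dist by (simp add: octagon_def x)
    moreover have "cycle_nodes p = VNode ` {s0, s1, s2, s3} \<union> CNode ` {r0, r1, r2, r3}"
      by (auto simp: cycle_nodes_def p x)
    ultimately show ?thesis by (rule that) (auto simp: p x)
  next
    case (VNode s0)
    obtain r1 where x1: "x1 = CNode r1" using arcs(1) VNode by (cases x1) auto
    obtain s1 where x2: "x2 = VNode s1" using arcs(2) x1 by (cases x2) auto
    obtain r2 where x3: "x3 = CNode r2" using arcs(3) x2 by (cases x3) auto
    obtain s2 where x4: "x4 = VNode s2" using arcs(4) x3 by (cases x4) auto
    obtain r3 where x5: "x5 = CNode r3" using arcs(5) x4 by (cases x5) auto
    obtain s3 where x6: "x6 = VNode s3" using arcs(6) x5 by (cases x6) auto
    obtain r0 where x7: "x7 = CNode r0" using arcs(7) x6 by (cases x7) auto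
    note x = VNode x1 x2 x3 x4 x5 x6 x7
    have "octagon H r0 s0 r1 s1 r2 s2 r3 s3"
      using arcs dist by (auto simp: octagon_def x)
    moreover have "cycle_nodes p = VNode ` {s0, s1, s2, s3} \<union> CNode ` {r0, r1, r2, r3}"
      by (auto simp: cycle_nodes_def p x)
    ultimately show ?thesis by (rule that) (auto simp: p x)
  qed
qed

text \<open>Each of the eight remaining pairs is joined by a path of length 3 on the cycle, and an
  edge between its ends would complete a rectangle. This rules out the second disjunct of
  \<open>has_chord\<close>.\<close>

lemma octagon_adj:
  assumes "no_rectangle H" "octagon H r0 s0 r1 s1 r2 s2 r3 s3" "adj H r s"
    "r \<in> {r0, r1, r2, r3}" "s \<in> {s0, s1, s2, s3}"
  shows "(r, s) \<in> {(r0, s0), (r1, s0), (r1, s1), (r2, s1), (r2, s2), (r3, s2), (r3, s3), (r0, s3)}"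
proof -
  note no = no_rectangleD[OF assms(1)]
  have o: "distinct [r0, r1, r2, r3]" "distinct [s0, s1, s2, s3]"
     "adj H r0 s0" "adj H r1 s0" "adj H r1 s1" "adj H r2 s1"
     "adj H r2 s2" "adj H r3 s2" "adj H r3 s3" "adj H r0 s3"
    using assms(2) by (simp_all add: octagon_def)
  have "\<not> adj H r0 s1" using no[of r0 s0 s1 r1] o by auto
  moreover have "\<not> adj H r0 s2" using no[of r0 s3 s2 r3] o by auto
  moreover have "\<not> adj H r1 s2" using no[of r1 s1 s2 r2] o by auto
  moreover have "\<not> adj H r1 s3" using no[of r1 s0 s3 r0] o by auto
  moreover have "\<not> adj H r2 s0" using no[of r2 s1 s0 r1] o by auto
  moreover have "\<not> adj H r2 s3" using no[of r2 s2 s3 r3] o by auto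
  moreover have "\<not> adj H r3 s0" using no[of r3 s3 s0 r0] o by auto
  moreover have "\<not> adj H r3 s1" using no[of r3 s2 s1 r2] o by auto
  ultimately show ?thesis using assms(3-5) by auto
qed

text \<open>Three internally disjoint paths join \<open>u\<close> and \<open>w\<close>: a short one
  through \<open>r\<close> and two of length 4. The long ones together form the 8-cycle, for which
  \<open>r\<close> is the outside c-node.\<close>

definition theta_graph ::
  "bit mat \<Rightarrow> nat \<Rightarrow> nat \<Rightarrow> nat \<Rightarrow> nat \<Rightarrow> nat \<Rightarrow> nat \<Rightarrow> nat \<Rightarrow> nat \<Rightarrow> nat \<Rightarrow> bool" where
  "theta_graph H r w u r1 v r2 q1 t q2 \<longleftrightarrow> hexagon H r w u r1 v r2 \<and> hexagon H r w u q1 t q2 \<and>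
     {r1, r2} \<inter> {q1, q2} = {} \<and> v \<noteq> t"

text \<open>Two cyclically consecutive v-nodes already share a c-node of the cycle, and
  \<open>r\<close> would be a second one. Only the two opposite pairs remain, one for each
  disjunct.\<close>

lemma theta_of_octagon:
  assumes "no_rectangle H" "octagon H r0 s0 r1 s1 r2 s2 r3 s3"
    "adj H r s" "adj H r s'" "s \<noteq> s'" "r \<notin> {r0, r1, r2, r3}"
    "s \<in> {s0, s1, s2, s3}" "s' \<in> {s0, s1, s2, s3}"
  shows "theta_graph H r s2 s0 r1 s1 r2 r0 s3 r3 \<or> theta_graph H r s3 s1 r2 s2 r3 r1 s0 r0"
proof -
  note no = no_rectangleD[OF assms(1)]
  have o: "distinct [r0, r1, r2, r3]" "distinct [s0, s1, s2, s3]"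
     "adj H r0 s0" "adj H r1 s0" "adj H r1 s1" "adj H r2 s1"
     "adj H r2 s2" "adj H r3 s2" "adj H r3 s3" "adj H r0 s3"
    using assms(2) by (simp_all add: octagon_def)
  have "\<not> (adj H r s0 \<and> adj H r s1)" using no[of r s0 s1 r1] o assms(6) by auto
  moreover have "\<not> (adj H r s1 \<and> adj H r s2)" using no[of r s1 s2 r2] o assms(6) by auto
  moreover have "\<not> (adj H r s2 \<and> adj H r s3)" using no[of r s2 s3 r3] o assms(6) by auto
  moreover have "\<not> (adj H r s3 \<and> adj H r s0)" using no[of r s3 s0 r0] o assms(6) by auto
  ultimately have "adj H r s0 \<and> adj H r s2 \<or> adj H r s1 \<and> adj H r s3"
    using assms(3-5,7,8) by auto
  then show ?thesis
    using o assms(6) by (auto simp: theta_graph_def hexagon_def)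
qed

lemma ex_chorded_8_cycle_iff_theta_graph:
  assumes "no_rectangle H"
  shows "(\<exists>p. is_cycle_of_length 8 (tanner_graph H) p \<and> has_chord (tanner_graph H) p) \<longleftrightarrow>
    (\<exists>r w u r1 v r2 q1 t q2. theta_graph H r w u r1 v r2 q1 t q2)"
proof safe
  fix p
  assume p: "is_cycle_of_length 8 (tanner_graph H) p" and ch: "has_chord (tanner_graph H) p"
  from p obtain r0 s0 r1 s1 r2 s2 r3 s3 where o: "octagon H r0 s0 r1 s1 r2 s2 r3 s3"
    and nodes: "cycle_nodes p = VNode ` {s0, s1, s2, s3} \<union> CNode ` {r0, r1, r2, r3}"
    and edges: "\<forall>(r, s) \<in> {(r0, s0), (r1, s0), (r1, s1), (r2, s1), (r2, s2), (r3, s2),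
       (r3, s3), (r0, s3)}. (VNode s, CNode r) \<in> set p \<or> (CNode r, VNode s) \<in> set p"
    by (rule octagon_of_8_cycle)
  have mem: "VNode s \<in> cycle_nodes p \<longleftrightarrow> s \<in> {s0, s1, s2, s3}"
    "CNode r \<in> cycle_nodes p \<longleftrightarrow> r \<in> {r0, r1, r2, r3}" for r s
    unfolding nodes by auto
  obtain r s s' where "adj H r s" "adj H r s'" "s \<noteq> s'" "r \<notin> {r0, r1, r2, r3}"
    "s \<in> {s0, s1, s2, s3}" "s' \<in> {s0, s1, s2, s3}"
    using ch octagon_adj[OF assms o] edges
    unfolding has_chord_def mem parcs_tanner_graph by blast
  from theta_of_octagon[OF assms o this]
  show "\<exists>r w u r1 v r2 q1 t q2. theta_graph H r w u r1 v r2 q1 t q2" by blast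
next
  fix r w u r1 v r2 q1 t q2
  assume th: "theta_graph H r w u r1 v r2 q1 t q2"
  \<comment> \<open>The cycle follows one long path from \<open>u\<close> to \<open>w\<close> and
    returns along the other.\<close>
  let ?p = "[(VNode u, CNode r1), (CNode r1, VNode v), (VNode v, CNode r2), (CNode r2, VNode w),
     (VNode w, CNode q2), (CNode q2, VNode t), (VNode t, CNode q1), (CNode q1, VNode u)]"
  have "is_cycle_of_length 8 (tanner_graph H) ?p"
    using th by (auto simp: theta_graph_def hexagon_def cycle_unfold
      pre_digraph.cas.simps pre_digraph.awalk_verts.simps adj_bounds)
  moreover have "has_chord (tanner_graph H) ?p"
    unfolding has_chord_def
    by (rule disjI1, rule exI[of _ r], rule exI[of _ u], rule exI[of _ w])
      (use th in \<open>auto simp: theta_graph_def hexagon_def cycle_nodes_def adj_bounds\<close>)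
  ultimately show "\<exists>p. is_cycle_of_length 8 (tanner_graph H) p \<and> has_chord (tanner_graph H) p"
    by blast
qed

section \<open>Closed hexagons of the base matrix and their symmetries\<close>

text \<open>This is the formula of \<open>e1\<close> with free indices; permuting the columns gives
  the other five entries of \<open>e_vector\<close>.\<close>

definition closed_hexagon ::
  "nat \<Rightarrow> enat mat \<Rightarrow> nat \<Rightarrow> nat \<Rightarrow> nat \<Rightarrow> nat \<Rightarrow> nat \<Rightarrow> nat \<Rightarrow> bool" where
  "closed_hexagon N M i1 i2 i3 j1 j2 j3 \<longleftrightarrow> diff_sum_mod N
     [(M $$ (i1, j1), M $$ (i1, j2)), (M $$ (i2, j2), M $$ (i2, j3)), (M $$ (i3, j3), M $$ (i3, j1))]
     = Some 0"

lemma closed_hexagon_iff: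
  "closed_hexagon N M i1 i2 i3 j1 j2 j3 \<longleftrightarrow>
     (\<forall>x \<in> {M $$ (i1, j1), M $$ (i1, j2), M $$ (i2, j2), M $$ (i2, j3), M $$ (i3, j3), M $$ (i3, j1)}.
       x \<noteq> \<infinity>) \<and>
     int N dvd (int (the_enat (M $$ (i1, j1))) - int (the_enat (M $$ (i1, j2)))) +
      (int (the_enat (M $$ (i2, j2))) - int (the_enat (M $$ (i2, j3)))) +
      (int (the_enat (M $$ (i3, j3))) - int (the_enat (M $$ (i3, j1))))"
  unfolding closed_hexagon_def diff_sum_mod_def dvd_eq_mod_eq_0 by (auto simp: add.assoc)

lemma closed_hexagon_rotate:
  "closed_hexagon N M i1 i2 i3 j1 j2 j3 \<longleftrightarrow> closed_hexagon N M i2 i3 i1 j2 j3 j1"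
  unfolding closed_hexagon_iff by (auto simp: algebra_simps)

text \<open>Traversing the hexagon backwards negates the sum, which does not affect divisibility by
  \<open>N\<close>.\<close>

lemma closed_hexagon_reflect:
  "closed_hexagon N M i1 i2 i3 j1 j2 j3 \<longleftrightarrow> closed_hexagon N M i1 i3 i2 j2 j1 j3"
proof -
  have "int N dvd (a - b) + (c - d) + (e - f) \<longleftrightarrow> int N dvd (b - a) + (f - e) + (d - c)"
    for a b c d e f :: int
    by (subst dvd_minus_iff[symmetric]) (simp add: algebra_simps)
  then show ?thesis unfolding closed_hexagon_iff by auto
qed

section \<open>Nodes and edges of the lifted graph\<close>

text \<open>The circulant condition compares positions inside blocks. Block offsets are multiples of
  \<open>N\<close>, so it can be stated with \<open>r\<close> and \<open>s\<close> themselves, which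
  makes sums along walks telescope.\<close>

lemma adj_parity_check_mat:
  assumes "N > 0"
  shows "adj (parity_check_mat N M) r s \<longleftrightarrow> r < dim_row M * N \<and> s < dim_col M * N \<and>
    M $$ (r div N, s div N) \<noteq> \<infinity> \<and>
    int N dvd int s - int r - int (the_enat (M $$ (r div N, s div N)))"
proof -
  have *: "s mod N = (b + r mod N) mod N \<longleftrightarrow> int N dvd int s - int r - int b" for b
  proof -
    have "s mod N = (b + r mod N) mod N \<longleftrightarrow> s mod N = (r + b) mod N"
      by (simp add: mod_simps add.commute)
    also have "\<dots> \<longleftrightarrow> int s mod int N = (int r + int b) mod int N"
      by (metis of_nat_add of_nat_eq_iff zmod_int)
    also have "\<dots> \<longleftrightarrow> int N dvd int s - int r - int b"
      by (simp add: mod_eq_dvd_iff algebra_simps)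
    finally show ?thesis .
  qed
  show ?thesis
  proof (cases "r < dim_row M * N \<and> s < dim_col M * N")
    case True
    then have "r div N < dim_row M" "s div N < dim_col M" "r mod N < N" "s mod N < N"
      using assms by (auto simp: less_mult_imp_div_less)
    with True show ?thesis
      by (cases "M $$ (r div N, s div N)")
        (simp_all add: adj_def parity_check_mat_def lifted_block_def circulant_perm_mat_def
          flip: *)
  qed (auto simp: adj_def parity_check_mat_def)
qed

lemma eq_of_div_eq_of_dvd_diff:
  fixes m n N :: nat
  assumes "m div N = n div N" "int N dvd int m - int n"
  shows "m = n"
proof -
  have "m mod N = n mod N"
    using assms(2) by (metis mod_eq_dvd_iff of_nat_eq_iff zmod_int)
  with assms(1) show ?thesis by (metis div_mult_mod_eq)
qed

text \<open>A circulant block has only one 1 in each row: both edges use the same exponent, which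
  cancels in the difference.\<close>

lemma adj_same_row_eq:
  assumes "N > 0" "adj (parity_check_mat N M) r s" "adj (parity_check_mat N M) r s'"
    "s div N = s' div N"
  shows "s = s'"
proof (rule eq_of_div_eq_of_dvd_diff[OF assms(4)])
  let ?b = "int (the_enat (M $$ (r div N, s div N)))"
  have "int N dvd (int s - int r - ?b) - (int s' - int r - ?b)"
    using assms by (auto simp only: adj_parity_check_mat intro: dvd_diff)
  then show "int N dvd int s - int s'" by simp
qed

lemma adj_same_col_eq:
  assumes "N > 0" "adj (parity_check_mat N M) r s" "adj (parity_check_mat N M) r' s"
    "r div N = r' div N"
  shows "r = r'"
proof (rule eq_of_div_eq_of_dvd_diff[OF assms(4)])
  let ?b = "int (the_enat (M $$ (r div N, s div N)))"
  have "int N dvd (int s - int r' - ?b) - (int s - int r - ?b)"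
    using assms by (auto simp only: adj_parity_check_mat intro: dvd_diff)
  then show "int N dvd int r - int r'" by simp
qed

lemma mult_add_less_mult:
  fixes i m n N :: nat
  assumes "i < n" "m < N"
  shows "i * N + m < n * N"
proof -
  have "i * N + m < Suc i * N" using assms(2) by simp
  also have "\<dots> \<le> n * N" using assms(1) by (intro mult_le_mono1) simp
  finally show ?thesis .
qed

lemma ex_adj_in_col_block:
  assumes "N > 0" "r < dim_row M * N" "j < dim_col M" "M $$ (r div N, j) \<noteq> \<infinity>"
  obtains s where "adj (parity_check_mat N M) r s" "s div N = j"
proof -
  let ?b = "the_enat (M $$ (r div N, j))"
  let ?s = "j * N + (r + ?b) mod N"
  have "int N dvd int ((r + ?b) mod N) - int (r + ?b)"
    by (simp only: zmod_int mod_eq_dvd_iff[symmetric] mod_mod_trivial)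
  then have "int N dvd int j * int N + (int ((r + ?b) mod N) - int (r + ?b))"
    by (intro dvd_add) auto
  then have "int N dvd int ?s - int r - int ?b" by (simp add: algebra_simps)
  then show thesis
    using assms by (intro that[of ?s]) (auto simp: adj_parity_check_mat mult_add_less_mult)
qed

lemma ex_adj_in_row_block:
  assumes "N > 0" "s < dim_col M * N" "i < dim_row M" "M $$ (i, s div N) \<noteq> \<infinity>"
  obtains r where "adj (parity_check_mat N M) r s" "r div N = i"
proof -
  let ?b = "the_enat (M $$ (i, s div N))"
  \<comment> \<open>The subtraction is done in the integers because \<open>s\<close> may be smaller
    than the exponent; \<open>mod\<close> brings the result back into the block.\<close>
  let ?m = "(int s - int ?b) mod int N"
  let ?r = "i * N + nat ?m"
  have m: "int (nat ?m) = ?m" "nat ?m < N" using assms(1) by (simp_all add: nat_less_iff)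
  have "int N dvd (int s - int ?b) - ?m"
    by (simp only: mod_eq_dvd_iff[symmetric] mod_mod_trivial)
  then have "int N dvd (int s - int ?b) - ?m - int i * int N"
    by (rule dvd_diff) simp
  then have "int N dvd int s - int ?r - int ?b" using m(1) by (simp add: algebra_simps)
  then show thesis
    using assms m(2) by (intro that[of ?r]) (auto simp: adj_parity_check_mat mult_add_less_mult)
qed

text \<open>In the alternating sum of the six edge congruences around the hexagon all node numbers
  cancel, leaving the sum of exponent differences. Five congruences are given, so the sixth is
  equivalent to the vanishing of that sum modulo \<open>N\<close>.\<close>

lemma adj_closes_hexagon_iff:
  fixes N M
  defines "H \<equiv> parity_check_mat N M"
  assumes "N > 0" "adj H r w" "adj H r u" "adj H r1 u" "adj H r1 v" "adj H r2 v"
  shows "adj H r2 w \<longleftrightarrow>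
    closed_hexagon N M (r div N) (r1 div N) (r2 div N) (w div N) (u div N) (v div N)"
proof -
  let ?b = "\<lambda>r s. int (the_enat (M $$ (r div N, s div N)))"
  let ?d = "\<lambda>r s. int s - int r - ?b r s"
  let ?t = "- ?d r w + ?d r u - ?d r1 u + ?d r1 v - ?d r2 v"
  let ?e = "(?b r w - ?b r u) + (?b r1 u - ?b r1 v) + (?b r2 v - ?b r2 w)"
  have fin: "M $$ (r div N, w div N) \<noteq> \<infinity>" "M $$ (r div N, u div N) \<noteq> \<infinity>"
     "M $$ (r1 div N, u div N) \<noteq> \<infinity>" "M $$ (r1 div N, v div N) \<noteq> \<infinity>"
     "M $$ (r2 div N, v div N) \<noteq> \<infinity>" "r2 < dim_row M * N" "w < dim_col M * N"
    and d: "int N dvd ?d r w" "int N dvd ?d r u" "int N dvd ?d r1 u" "int N dvd ?d r1 v"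
      "int N dvd ?d r2 v"
    using assms(2-) unfolding H_def by (auto simp: adj_parity_check_mat)
  have "int N dvd - ?d r w" using d(1) by (simp only: dvd_minus_iff)
  with d(2-) have "int N dvd ?t" by (simp only: dvd_add dvd_diff)
  then have "int N dvd ?d r2 w \<longleftrightarrow> int N dvd ?t + ?d r2 w"
    by (rule dvd_add_right_iff[symmetric])
  also have "?t + ?d r2 w = ?e" by (simp add: algebra_simps)
  finally show ?thesis
    using fin unfolding H_def adj_parity_check_mat[OF assms(2)] closed_hexagon_iff by auto
qed

text \<open>Sending each node to the same position in the original block preserves edges, and it is
  injective because the index lists are distinct. A rectangle of the submatrix would thus give one
  of the full matrix.\<close>

lemma no_rectangle_select_mat:
  assumes "N > 0" "no_rectangle (parity_check_mat N B)"
    "distinct is" "distinct js" "set is \<subseteq> {..<dim_row B}" "set js \<subseteq> {..<dim_col B}"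
  shows "no_rectangle (parity_check_mat N (select_mat B is js))"
  unfolding no_rectangle_def
proof (intro allI impI, rule ccontr)
  fix r r' s s'
  let ?H = "parity_check_mat N (select_mat B is js)"
  let ?f = "\<lambda>r. is ! (r div N) * N + r mod N" and ?g = "\<lambda>s. js ! (s div N) * N + s mod N"
  assume *: "r \<noteq> r'" "adj ?H r s" "adj ?H r s'" "adj ?H r' s" "adj ?H r' s'" "s \<noteq> s'"
  have dims: "dim_row (select_mat B is js) = length is" "dim_col (select_mat B is js) = length js"
    by (simp_all add: select_mat_def)
  have lift: "adj (parity_check_mat N B) (?f r) (?g s)" if "adj ?H r s" for r s
  proof -
    have rs: "r div N < length is" "s div N < length js"
      using that by (auto simp: adj_parity_check_mat[OF assms(1)] dims less_mult_imp_div_less)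
    then have lt: "is ! (r div N) < dim_row B" "js ! (s div N) < dim_col B"
      using assms(5,6) nth_mem by blast+
    let ?b = "int (the_enat (B $$ (is ! (r div N), js ! (s div N))))"
    have "int N dvd int s - int r - ?b" and fin: "B $$ (is ! (r div N), js ! (s div N)) \<noteq> \<infinity>"
      using that rs by (auto simp: adj_parity_check_mat[OF assms(1)] select_mat_def)
    then have "int N dvd int (s div N * N + s mod N) - int (r div N * N + r mod N) - ?b"
      by simp
    \<comment> \<open>Changing the two block indices alters \<open>s - r\<close> by a multiple of
      \<open>N\<close>, which is the summand added here.\<close>
    then have "int N dvd (int (s div N * N + s mod N) - int (r div N * N + r mod N) - ?b) +
        int N * (int (r div N) - int (s div N) + int (js ! (s div N)) - int (is ! (r div N)))"
      by (intro dvd_add) auto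
    also have "\<dots> = int (?g s) - int (?f r) - ?b"
      unfolding of_nat_add of_nat_mult by (simp only: algebra_simps)
    finally show ?thesis
      using lt fin assms(1) by (simp add: adj_parity_check_mat mult_add_less_mult)
  qed
  have inj: "k = k'" if "xs ! (k div N) * N + k mod N = xs ! (k' div N) * N + k' mod N"
      "distinct xs" "k div N < length xs" "k' div N < length xs" for xs k k'
  proof -
    have "xs ! (k div N) = xs ! (k' div N)"
      using arg_cong[OF that(1), of "\<lambda>x. x div N"] assms(1) by simp
    moreover have "k mod N = k' mod N"
      using arg_cong[OF that(1), of "\<lambda>x. x mod N"] by simp
    ultimately show ?thesis
      using that(2-) by (metis nth_eq_iff_index_eq div_mult_mod_eq)
  qed
  have bnds: "r div N < length is" "r' div N < length is" "s div N < length js" "s' div N < length js"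
    using * by (auto simp: adj_parity_check_mat[OF assms(1)] dims less_mult_imp_div_less)
  have "?f r = ?f r' \<or> ?g s = ?g s'"
    by (rule no_rectangleD[OF assms(2)]) (intro lift *)+
  with inj[of "is" r r'] inj[of js s s'] bnds assms(3,4) *(1,6) show False by auto
qed

section \<open>Theta graphs in lifts of 3 x 3 matrices\<close>

lemma ex_theta_graph_iff_closed_hexagons:
  fixes N M
  defines "H \<equiv> parity_check_mat N M"
  assumes "N > 0" "M \<in> carrier_mat 3 3" "no_rectangle H"
  shows "(\<exists>r w u r1 v r2 q1 t q2. theta_graph H r w u r1 v r2 q1 t q2) \<longleftrightarrow>
    (\<exists>i1 i2 i3 j1 j2 j3. {i1, i2, i3} \<subseteq> {..<3} \<and> distinct [i1, i2, i3] \<and>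
      {j1, j2, j3} \<subseteq> {..<3} \<and> distinct [j1, j2, j3] \<and>
      closed_hexagon N M i1 i2 i3 j1 j2 j3 \<and> closed_hexagon N M i1 i2 i3 j2 j1 j3)"
    (is "?theta \<longleftrightarrow> ?closed")
proof
  note row = adj_same_row_eq[OF assms(2), of M, folded H_def]
    and col = adj_same_col_eq[OF assms(2), of M, folded H_def]
    and closes = adj_closes_hexagon_iff[OF assms(2), of M, folded H_def]
  assume ?theta
  then obtain r w u r1 v r2 q1 t q2 where th: "theta_graph H r w u r1 v r2 q1 t q2" by blast
  have 1: "distinct [r, r1, r2]" "distinct [w, u, v]"
     "adj H r w" "adj H r u" "adj H r1 u" "adj H r1 v" "adj H r2 v" "adj H r2 w"
    and 2: "distinct [r, q1, q2]" "distinct [w, u, t]"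
     "adj H q1 u" "adj H q1 t" "adj H q2 t" "adj H q2 w"
    and 3: "r1 \<noteq> q1" "r1 \<noteq> q2" "r2 \<noteq> q1" "r2 \<noteq> q2" "v \<noteq> t"
    using th by (auto simp: theta_graph_def hexagon_def)
  have div3: "x div N < 3" "y div N < 3" if "adj H x y" for x y
    using that assms(2,3) unfolding H_def
    by (auto simp: adj_parity_check_mat less_mult_imp_div_less)
  \<comment> \<open>Distinct neighbours of a common node lie in different blocks.\<close>
  have rows: "r div N \<noteq> r1 div N" "r div N \<noteq> r2 div N" "r1 div N \<noteq> r2 div N" "r2 div N \<noteq> r1 div N"
    "r div N \<noteq> q1 div N" "r div N \<noteq> q2 div N" "r1 div N \<noteq> q1 div N" "r2 div N \<noteq> q2 div N"
    and cols: "w div N \<noteq> u div N" "w div N \<noteq> v div N" "u div N \<noteq> v div N"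
    "w div N \<noteq> t div N" "u div N \<noteq> t div N"
    using 1 2 3 row[OF 1(3) 1(4)] row[OF 1(5) 1(6)] row[OF 1(7) 1(8)]
      row[OF 2(3) 2(4)] row[OF 2(5) 2(6)] col[OF 1(4) 1(5)] col[OF 1(6) 1(7)] col[OF 1(3) 1(8)]
      col[OF 1(4) 2(3)] col[OF 2(4) 2(5)] col[OF 1(3) 2(6)] col[OF 1(5) 2(3)] col[OF 1(8) 2(6)]
    by (auto simp: eq_commute)
  have three: "z = z'" if "x < 3" "y < 3" "z < 3" "z' < 3" "x \<noteq> y" "x \<noteq> z" "y \<noteq> z" "x \<noteq> z'" "y \<noteq> z'"
    for x y z z' :: nat
    using that by linarith
  note div3s = div3[OF 1(3)] div3[OF 1(4)] div3[OF 1(5)] div3[OF 1(7)] div3[OF 2(4)] div3[OF 2(5)]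
  \<comment> \<open>The neighbours \<open>r\<close>, \<open>r1\<close>, \<open>q1\<close> of
    \<open>u\<close> occupy different row blocks, and only three exist, so \<open>q1\<close> falls
    into the block of \<open>r2\<close>. The same count at \<open>w\<close> places
    \<open>q2\<close>: the second path visits the row blocks in the opposite order.\<close>
  have "q1 div N = r2 div N" by (rule three[of "r div N" "r1 div N"]) (fact rows div3s)+
  moreover have "q2 div N = r1 div N" by (rule three[of "r div N" "r2 div N"]) (fact rows div3s)+
  moreover have "t div N = v div N" by (rule three[of "w div N" "u div N"]) (fact cols div3s)+
  ultimately have q: "q1 div N = r2 div N" "q2 div N = r1 div N" "t div N = v div N" .
  have "closed_hexagon N M (r div N) (r1 div N) (r2 div N) (w div N) (u div N) (v div N)"
    using closes[of r w u r1 v r2] 1 by simp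
  moreover have "closed_hexagon N M (r div N) (r2 div N) (r1 div N) (w div N) (u div N) (v div N)"
    using closes[of r w u q1 t q2] 1 2 q by simp
  \<comment> \<open>Reflection turns the exchange of two rows into an exchange of two
    columns.\<close>
  then have "closed_hexagon N M (r div N) (r1 div N) (r2 div N) (u div N) (w div N) (v div N)"
    by (rule closed_hexagon_reflect[THEN iffD1])
  moreover have "{r div N, r1 div N, r2 div N} \<subseteq> {..<3}" "{w div N, u div N, v div N} \<subseteq> {..<3}"
    using div3s by simp_all
  moreover have "distinct [r div N, r1 div N, r2 div N]" "distinct [w div N, u div N, v div N]"
    using rows(1-3) cols(1-3) by simp_all
  ultimately show ?closed by blast
next
  note row = adj_same_row_eq[OF assms(2), of M, folded H_def]
    and col = adj_same_col_eq[OF assms(2), of M, folded H_def]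
    and closes = adj_closes_hexagon_iff[OF assms(2), of M, folded H_def]
    and ex_col = ex_adj_in_col_block[OF assms(2), of _ M, folded H_def]
    and ex_row = ex_adj_in_row_block[OF assms(2), of _ M, folded H_def]
    and no = no_rectangleD[OF assms(4)]
  assume ?closed
  then obtain i1 i2 i3 j1 j2 j3 where ij: "{i1, i2, i3} \<subseteq> {..<3}" "distinct [i1, i2, i3]"
      "{j1, j2, j3} \<subseteq> {..<3}" "distinct [j1, j2, j3]"
    and c1: "closed_hexagon N M i1 i2 i3 j1 j2 j3"
    and c2': "closed_hexagon N M i1 i2 i3 j2 j1 j3"
    by (elim exE conjE) (rule that)
  have c2: "closed_hexagon N M i1 i3 i2 j1 j2 j3"
    using c2' by (rule closed_hexagon_reflect[THEN iffD1])
  have fin: "M $$ (i1, j1) \<noteq> \<infinity>" "M $$ (i1, j2) \<noteq> \<infinity>" "M $$ (i2, j2) \<noteq> \<infinity>" "M $$ (i2, j3) \<noteq> \<infinity>"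
    "M $$ (i3, j2) \<noteq> \<infinity>" "M $$ (i3, j3) \<noteq> \<infinity>"
    using c1 c2 unfolding closed_hexagon_iff by auto
  have dims: "dim_row M = 3" "dim_col M = 3" using assms(3) by auto
  have bnd: "x < dim_row M * N" "y < dim_col M * N" if "adj H x y" for x y
    using that assms(2) unfolding H_def by (auto simp: adj_parity_check_mat)
  \<comment> \<open>Any position in row block \<open>i1\<close> would serve as the common c-node;
    the first is taken. Both hexagons are then lifted edge by edge from it.\<close>
  define r where "r = i1 * N"
  have r: "r div N = i1" "r < dim_row M * N" using ij assms(2) by (auto simp: r_def dims)
  obtain w where w: "adj H r w" "w div N = j1" using ex_col[of r j1] r ij fin dims by auto
  obtain u where u: "adj H r u" "u div N = j2" using ex_col[of r j2] r ij fin dims by auto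
  obtain r1 where r1: "adj H r1 u" "r1 div N = i2"
    using ex_row[of u i2] bnd[OF u(1)] u ij fin dims by auto
  obtain v where v: "adj H r1 v" "v div N = j3"
    using ex_col[of r1 j3] bnd[OF r1(1)] r1 ij fin dims by auto
  obtain r2 where r2: "adj H r2 v" "r2 div N = i3"
    using ex_row[of v i3] bnd[OF v(1)] v ij fin dims by auto
  obtain q1 where q1: "adj H q1 u" "q1 div N = i3"
    using ex_row[of u i3] bnd[OF u(1)] u ij fin dims by auto
  obtain t where t: "adj H q1 t" "t div N = j3"
    using ex_col[of q1 j3] bnd[OF q1(1)] q1 ij fin dims by auto
  obtain q2 where q2: "adj H q2 t" "q2 div N = i2"
    using ex_row[of t i2] bnd[OF t(1)] t ij fin dims by auto
  \<comment> \<open>The lifted paths return to \<open>w\<close> itself, not merely to its block,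
    because the base hexagons are closed.\<close>
  have r2w: "adj H r2 w" using closes[of r w u r1 v r2] r w u r1 v r2 c1 by simp
  have q2w: "adj H q2 w" using closes[of r w u q1 t q2] r w u q1 t q2 c2 by simp
  have ne: "r \<noteq> r1" "r \<noteq> r2" "r1 \<noteq> r2" "r \<noteq> q1" "r \<noteq> q2" "q1 \<noteq> q2" "r1 \<noteq> q1" "r2 \<noteq> q2"
     "w \<noteq> u" "w \<noteq> v" "u \<noteq> v" "w \<noteq> t" "u \<noteq> t"
    using ij r(1) w(2) u(2) r1(2) v(2) r2(2) q1(2) t(2) q2(2) by auto
  \<comment> \<open>Nodes of the two long paths can coincide only within a block. Equality of
    \<open>r1\<close> and \<open>q2\<close>, or of \<open>r2\<close> and \<open>q1\<close>, would
    give a second common neighbour of \<open>u\<close> and \<open>w\<close> besides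
    \<open>r\<close>. If \<open>v\<close> and \<open>t\<close> were equal, then \<open>r1\<close>
    and \<open>q2\<close> would be neighbours of it in one block, hence equal.\<close>
  have "r1 \<noteq> q2" using no[of r u w r1] w(1) u(1) r1(1) q2w ne by auto
  moreover have "r2 \<noteq> q1" using no[of r u w r2] w(1) u(1) q1(1) r2w ne by auto
  moreover have "v \<noteq> t" using col[of r1 v q2] v(1) q2 r1(2) \<open>r1 \<noteq> q2\<close> by auto
  ultimately have "theta_graph H r w u r1 v r2 q1 t q2"
    using ne w(1) u(1) r1(1) v(1) r2(1) q1(1) t(1) q2(1) r2w q2w
    by (simp add: theta_graph_def hexagon_def)
  then show ?theta by blast
qed

section \<open>Enumeration of the pairs of hexagons\<close>

text \<open>Rotations and reflections realise every permutation of the three rows, so rows can be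
  put in increasing order at the cost of permuting columns. The six column orders then represent all
  hexagons.\<close>

lemma closed_hexagon_sort_rows:
  "closed_hexagon N M (Suc 0) 2 0 a b c = closed_hexagon N M 0 (Suc 0) 2 c a b"
  "closed_hexagon N M 2 0 (Suc 0) a b c = closed_hexagon N M 0 (Suc 0) 2 b c a"
  "closed_hexagon N M 0 2 (Suc 0) a b c = closed_hexagon N M 0 (Suc 0) 2 b a c"
  "closed_hexagon N M 2 (Suc 0) 0 a b c = closed_hexagon N M 0 (Suc 0) 2 a c b"
  "closed_hexagon N M (Suc 0) 0 2 a b c = closed_hexagon N M 0 (Suc 0) 2 c b a"
  by (metis closed_hexagon_rotate closed_hexagon_reflect)+

theorem theorem6:
  fixes N c d i1 i2 i3 j1 j2 j3 :: nat
    and B :: "enat mat" and G :: "node pair_pre_digraph"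
    and e1 e2 e3 e4 e5 e6 :: "int option"
  assumes "B \<in> carrier_mat c d"
    and "exponent_matrix N B"
    and "\<nexists>p. is_cycle_of_length 4 (tanner_graph (parity_check_mat N B)) p"
    and "distinct [i1, i2, i3]" and "i1 < c" and "i2 < c" and "i3 < c"
    and "distinct [j1, j2, j3]" and "j1 < d" and "j2 < d" and "j3 < d"
    and "[e1, e2, e3, e4, e5, e6] = e_vector N B i1 i2 i3 j1 j2 j3"
    and "G = tanner_graph (parity_check_mat N (select_mat B [i1, i2, i3] [j1, j2, j3]))"
  shows "(\<nexists>p. is_cycle_of_length 8 G p \<and> has_chord G p) \<longleftrightarrow>
    \<not> (e1 = Some 0 \<and> e6 = Some 0 \<or>
       e1 = Some 0 \<and> e2 = Some 0 \<or>
       e1 = Some 0 \<and> e4 = Some 0 \<or>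
       e2 = Some 0 \<and> e5 = Some 0 \<or>
       e2 = Some 0 \<and> e3 = Some 0 \<or>
       e3 = Some 0 \<and> e4 = Some 0 \<or>
       e3 = Some 0 \<and> e6 = Some 0 \<or>
       e4 = Some 0 \<and> e5 = Some 0 \<or>
       e5 = Some 0 \<and> e6 = Some 0)"
proof -
  define M where "M = select_mat B [i1, i2, i3] [j1, j2, j3]"
  let ?C = "closed_hexagon N M 0 (Suc 0) 2"
  have N: "N > 0" using assms(2) by (simp add: exponent_matrix_def)
  have no: "no_rectangle (parity_check_mat N M)"
    unfolding M_def using assms by (intro no_rectangle_select_mat no_rectangle_if_no_4_cycle N) auto
  have M: "M \<in> carrier_mat 3 3" by (rule carrier_matI) (simp_all add: M_def select_mat_def)
  have e: "e1 = Some 0 \<longleftrightarrow> ?C 0 (Suc 0) 2" "e2 = Some 0 \<longleftrightarrow> ?C 0 2 (Suc 0)"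
    "e3 = Some 0 \<longleftrightarrow> ?C (Suc 0) 2 0" "e4 = Some 0 \<longleftrightarrow> ?C 2 (Suc 0) 0"
    "e5 = Some 0 \<longleftrightarrow> ?C 2 0 (Suc 0)" "e6 = Some 0 \<longleftrightarrow> ?C (Suc 0) 0 2"
    using assms(12)
    by (simp_all add: e_vector_def Let_def closed_hexagon_def M_def select_mat_def numeral_2_eq_2)
  have three: "(\<exists>x y z. {x, y, z} \<subseteq> {..<3} \<and> distinct [x, y, z] \<and> P x y z) \<longleftrightarrow>
      P 0 (Suc 0) 2 \<or> P 0 2 (Suc 0) \<or> P (Suc 0) 0 2 \<or> P (Suc 0) 2 0 \<or> P 2 0 (Suc 0) \<or> P 2 (Suc 0) 0"
    for P :: "nat \<Rightarrow> nat \<Rightarrow> nat \<Rightarrow> bool"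
  proof -
    have "{..<3} = {0, Suc 0, 2}" by auto
    then have "(\<exists>x y z. {x, y, z} \<subseteq> {..<3} \<and> distinct [x, y, z] \<and> P x y z) \<longleftrightarrow>
        (\<exists>x \<in> {0, Suc 0, 2}. \<exists>y \<in> {0, Suc 0, 2}. \<exists>z \<in> {0, Suc 0, 2}. distinct [x, y, z] \<and> P x y z)"
      by (simp only: insert_subset) blast
    then show ?thesis by simp
  qed
  have "(\<exists>p. is_cycle_of_length 8 G p \<and> has_chord G p) \<longleftrightarrow>
    (\<exists>i1 i2 i3. {i1, i2, i3} \<subseteq> {..<3} \<and> distinct [i1, i2, i3] \<and>
      (\<exists>j1 j2 j3. {j1, j2, j3} \<subseteq> {..<3} \<and> distinct [j1, j2, j3] \<and>
      closed_hexagon N M i1 i2 i3 j1 j2 j3 \<and> closed_hexagon N M i1 i2 i3 j2 j1 j3))"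
    unfolding assms(13) M_def[symmetric] ex_chorded_8_cycle_iff_theta_graph[OF no]
      ex_theta_graph_iff_closed_hexagons[OF N M no] by (simp only: ex_simps)
  \<comment> \<open>All 36 choices of row and column order are expanded. Exchanging two columns
    changes the parity of the column order; \<open>e1\<close>, \<open>e3\<close>, \<open>e5\<close>
    carry the even orders and \<open>e2\<close>, \<open>e4\<close>, \<open>e6\<close> the odd ones,
    so the 3 * 3 mixed pairs remain.\<close>
  also have "\<dots> \<longleftrightarrow> ?C 0 (Suc 0) 2 \<and> ?C (Suc 0) 0 2 \<or> ?C 0 (Suc 0) 2 \<and> ?C 0 2 (Suc 0) \<or>
       ?C 0 (Suc 0) 2 \<and> ?C 2 (Suc 0) 0 \<or> ?C 0 2 (Suc 0) \<and> ?C 2 0 (Suc 0) \<or>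
       ?C 0 2 (Suc 0) \<and> ?C (Suc 0) 2 0 \<or> ?C (Suc 0) 2 0 \<and> ?C 2 (Suc 0) 0 \<or>
       ?C (Suc 0) 2 0 \<and> ?C (Suc 0) 0 2 \<or> ?C 2 (Suc 0) 0 \<and> ?C 2 0 (Suc 0) \<or>
       ?C 2 0 (Suc 0) \<and> ?C (Suc 0) 0 2"
    unfolding three closed_hexagon_sort_rows
    by (simp only: conj_ac disj_ac conj_absorb disj_absorb disj_left_absorb)
  finally show ?thesis unfolding e by (rule arg_cong[where f = Not])
qed

end
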